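(* Let $S=K[t_1,\ldots,t_s]$ be a polynomial ring over a field $K$ and let $I=(t^{v_1},\ldots,t^{v_q})$ be an ideal of $S$ generated by monomials of degree $2$, where $\{t^{v_1},\ldots,t^{v_q}\}$ is the minimal set of monomial generators of $I$. Let $$\mathcal{B}=\{e_{s+1}\}\cup\{e_i+e_{s+1}\}_{i=1}^s\cup\{(v_i,1)\}_{i=1}^q\subset\mathbb{R}^{s+1}.$$ Then $I$ is a normal ideal if and only if $\mathcal{B}$ is a Hilbert basis.
   Context: $\mathbb{N}=\{0,1,2,\ldots\}$. For $a\in\mathbb{N}^s$, $t^a:=t_1^{a_1}\cdots t_s^{a_s}$. $e_i$ denotes the $i$-th unit vector of $\mathbb{R}^{s+1}$. A finite set $\mathcal{B}\subset\mathbb{R}^{s+1}$ is a Hilbert basis if $\mathbb{Z}^{s+1}\cap\mathbb{R}_+\mathcal{B}=\mathbb{N}\mathcal{B}$, where $\mathbb{R}_+\mathcal{B}$ is the cone generated by $\mathcal{B}$ (all linear combinations with nonnegative real coefficients) and $\mathbb{N}\mathcal{B}$ is the semigroup of all combinations of $\mathcal{B}$ with coefficients in $\mathbb{N}$. An ideal $I$ is normal if $I^n=\overline{I^n}$ for all $n\geq 1$, where $\overline{I^n}$ is the integral closure of $I^n$. *)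

theory Defs
  imports "HOL-Analysis.Analysis" "HOL-Library.Poly_Mapping"
begin

text \<open>
  The polynomial ring \<open>K[t\<^sub>1, \<dots>, t\<^sub>s]\<close> is the monoid algebra of \<open>\<nat>\<^sup>s\<close> over \<open>K\<close>; the variables are
  indexed by a finite type \<open>'n\<close> with \<open>s = CARD('n)\<close>.
\<close>

type_synonym ('k, 'n) mpolynomial = "(nat ^ 'n) \<Rightarrow>\<^sub>0 'k"

definition monomial :: "nat ^ 'n \<Rightarrow> ('k::field, 'n::finite) mpolynomial" where
  "monomial a = Poly_Mapping.single a 1"

definition monomial_degree :: "nat ^ 'n::finite \<Rightarrow> nat" where
  "monomial_degree a = (\<Sum>i\<in>UNIV. a $ i)"

text \<open>A commutative ring is a module over itself, and the ideals are the submodules.\<close>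

lemma module_mult: "module ((*) :: 'a::comm_ring_1 \<Rightarrow> 'a \<Rightarrow> 'a)"
  by unfold_locales (simp_all add: algebra_simps)

definition ideal_generated :: "'a::comm_ring_1 set \<Rightarrow> 'a set" where
  "ideal_generated = module.span (*)"

primrec ideal_power :: "'a::comm_ring_1 set \<Rightarrow> nat \<Rightarrow> 'a set" where
  "ideal_power I 0 = UNIV"
| "ideal_power I (Suc n) = ideal_generated {x * y | x y. x \<in> I \<and> y \<in> ideal_power I n}"

definition integral_closure :: "'a::comm_ring_1 set \<Rightarrow> 'a set" where
  "integral_closure I =
    {f. \<exists>m\<ge>1. \<exists>a. (\<forall>i\<in>{1..m}. a i \<in> ideal_power I i) \<and>
          f ^ m + (\<Sum>i=1..m. a i * f ^ (m - i)) = 0}"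

definition normal_ideal :: "'a::comm_ring_1 set \<Rightarrow> bool" where
  "normal_ideal I \<longleftrightarrow> (\<forall>n\<ge>1. ideal_power I n = integral_closure (ideal_power I n))"

definition minimal_monomial_generators ::
    "(nat ^ 'n) set \<Rightarrow> ('k::field, 'n::finite) mpolynomial set \<Rightarrow> bool" where
  "minimal_monomial_generators V I \<longleftrightarrow>
    ideal_generated (monomial ` V) = I \<and>
    (\<forall>W. W \<subset> V \<longrightarrow> ideal_generated (monomial ` W) \<noteq> I)"

definition integer_lattice :: "(real ^ 'm::finite) set" where
  "integer_lattice = {x. \<forall>i. x $ i \<in> \<int>}"

text \<open>The next two sets are only meaningful for finite \<open>B\<close>, as required in \<open>hilbert_basis\<close> below.\<close>

definition generated_cone :: "(real ^ 'm::finite) set \<Rightarrow> (real ^ 'm) set" where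
  "generated_cone B = {\<Sum>b\<in>B. c b *\<^sub>R b | c. \<forall>b\<in>B. 0 \<le> c b}"

definition generated_semigroup :: "(real ^ 'm::finite) set \<Rightarrow> (real ^ 'm) set" where
  "generated_semigroup B = {\<Sum>b\<in>B. real (k b) *\<^sub>R b | k. True}"

definition hilbert_basis :: "(real ^ 'm::finite) set \<Rightarrow> bool" where
  "hilbert_basis B \<longleftrightarrow>
    finite B \<and> integer_lattice \<inter> generated_cone B = generated_semigroup B"

text \<open>
  \<open>\<real>\<^sup>s\<^sup>+\<^sup>1\<close> is rendered as \<open>real ^ 'n option\<close>: \<open>Some i\<close> are the first \<open>s\<close> coordinates and
  \<open>None\<close> is the coordinate \<open>s + 1\<close>.
\<close>

definition lift_exponent :: "nat ^ 'n::finite \<Rightarrow> real ^ 'n option" where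
  "lift_exponent v = (\<chi> j. case j of Some i \<Rightarrow> real (v $ i) | None \<Rightarrow> 1)"

definition ehrhart_vectors :: "(nat ^ 'n::finite) set \<Rightarrow> (real ^ 'n option) set" where
  "ehrhart_vectors V =
    {axis None 1} \<union> range (\<lambda>i. axis (Some i) 1 + axis None 1) \<union> lift_exponent ` V"

end

theory Submission
  imports Defs "HOL-Library.Set_Algebras"
begin

text \<open>
  Both sides of the equivalence say that a fractional packing problem has no advantage over the
  integral one: whenever an exponent \<open>a\<close> dominates a combination \<open>\<Sum>v\<in>V. c v * v\<close> with real
  weights \<open>c v \<ge> 0\<close> of sum \<open>n \<ge> 1\<close>, it dominates a sum of \<open>n\<close> elements of \<open>V\<close>.
  The first set of exponents, \<open>newton_exponents V n\<close>, consists of the lattice points of \<open>n\<close> times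
  the Newton polyhedron of \<open>I\<close>; the second, \<open>power_exponents V n\<close>, of the exponents of the
  monomials in \<open>I\<^sup>n\<close>.

  For normality, \<open>I\<^sup>n\<close> is the set of polynomials whose exponents all lie in \<open>power_exponents V n\<close>.
  A monomial with exponent in \<open>newton_exponents V n\<close> is integral over \<open>I\<^sup>n\<close>: simultaneous
  Diophantine approximation of the weights makes some power of it lie in the same power
  of \<open>I\<^sup>n\<close> (\<open>newton_exponents_multiple\<close>). Conversely, if a polynomial \<open>f\<close> has an exponent outside
  the Newton polyhedron, a hyperplane separates this exponent from the polyhedron; the powers
  of \<open>f\<close> keep the corresponding extreme term, which no equation of integral dependence can cancel
  (\<open>keys_integral_closure_subset\<close>).

  For the Hilbert basis, degree two makes the last coordinate of a combination
  a matter of bookkeeping. Let \<open>\<bar>a\<bar>\<close> denote the degree of \<open>a\<close>. If \<open>(a, b)\<close> is a combination with coefficients \<open>c v\<close> for the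
  vectors \<open>(v, 1)\<close>, then comparing coordinate sums shows that the coefficients of the
  \<open>e\<^sub>i + e\<^sub>s\<^sub>+\<^sub>1\<close> add up to \<open>\<bar>a\<bar> - 2 * sum c V\<close>, so what is left for \<open>e\<^sub>s\<^sub>+\<^sub>1\<close> is
  \<open>b - \<bar>a\<bar> + sum c V\<close>. Hence \<open>(a, b)\<close> is a combination precisely if \<open>a\<close> dominates
  \<open>\<Sum>v\<in>V. c v * v\<close> for some \<open>c\<close> of total weight at least \<open>n = \<bar>a\<bar> - b\<close>, and this holds for
  nonnegative real and for natural coefficients alike.
\<close>

section \<open>Monomial ideals\<close>

definition supported_on :: "(nat ^ 'n) set \<Rightarrow> ('k::field, 'n::finite) mpolynomial set" where
  "supported_on E = {f. Poly_Mapping.keys f \<subseteq> E}"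

definition up_closed :: "'a::plus set \<Rightarrow> bool" where
  "up_closed E \<longleftrightarrow> (\<forall>a\<in>E. \<forall>b. a + b \<in> E)"

lemma keys_multE:
  assumes "x \<in> Poly_Mapping.keys (f * g)"
  obtains a b where "x = a + b" "a \<in> Poly_Mapping.keys f" "b \<in> Poly_Mapping.keys g"
  using assms keys_mult[of f g] by blast

lemma sum_single_keys:
  "(\<Sum>a\<in>Poly_Mapping.keys f. Poly_Mapping.single a (Poly_Mapping.lookup f a)) = f"
proof (rule poly_mapping_eqI)
  fix b
  have "(\<Sum>a\<in>Poly_Mapping.keys f. Poly_Mapping.lookup f a when a = b) =
      (\<Sum>a\<in>Poly_Mapping.keys f. if a = b then Poly_Mapping.lookup f a else 0)"
    by (simp add: when_def)
  also have "\<dots> = Poly_Mapping.lookup f b"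
    by (simp add: in_keys_iff)
  finally show "Poly_Mapping.lookup
      (\<Sum>a\<in>Poly_Mapping.keys f. Poly_Mapping.single a (Poly_Mapping.lookup f a)) b =
      Poly_Mapping.lookup f b"
    by (simp add: lookup_sum lookup_single)
qed

lemma subspace_supported_on:
  assumes "up_closed E"
  shows "module.subspace (*) (supported_on E :: ('k::field, 'n::finite) mpolynomial set)"
proof (rule module.subspaceI[OF module_mult])
  fix x y :: "('k, 'n) mpolynomial"
  show "0 \<in> (supported_on E :: ('k, 'n) mpolynomial set)"
    by (simp add: supported_on_def)
  show "x + y \<in> supported_on E" if "x \<in> supported_on E" "y \<in> supported_on E"
    using that keys_add[of x y] by (auto simp: supported_on_def)
  show "x * y \<in> supported_on E" if "y \<in> supported_on E"
  proof -
    have "a + b \<in> E" if "b \<in> Poly_Mapping.keys y" for a b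
    proof -
      have "b \<in> E"
        using that \<open>y \<in> supported_on E\<close> by (auto simp: supported_on_def)
      then show ?thesis
        using assms by (subst add.commute) (auto simp: up_closed_def)
    qed
    then show ?thesis
      by (auto simp: supported_on_def elim!: keys_multE)
  qed
qed

text \<open>
  A polynomial is the sum of its terms, so it belongs to every ideal that contains them.
\<close>

lemma ideal_generated_eq_supported_on:
  fixes S :: "('k::field, 'n::finite) mpolynomial set"
  assumes up: "up_closed E"
    and sub: "S \<subseteq> supported_on E"
    and terms: "\<And>a c. a \<in> E \<Longrightarrow> Poly_Mapping.single a c \<in> ideal_generated S"
  shows "ideal_generated S = supported_on E"
proof
  show "ideal_generated S \<subseteq> supported_on E"
    unfolding ideal_generated_def
    by (rule module.span_minimal[OF module_mult sub subspace_supported_on[OF up]])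
  show "supported_on E \<subseteq> ideal_generated S"
  proof
    fix f :: "('k, 'n) mpolynomial"
    assume "f \<in> supported_on E"
    then have "(\<Sum>a\<in>Poly_Mapping.keys f. Poly_Mapping.single a (Poly_Mapping.lookup f a))
        \<in> ideal_generated S"
      unfolding ideal_generated_def
      by (intro module.span_sum[OF module_mult])
        (use terms in \<open>auto simp: supported_on_def ideal_generated_def\<close>)
    then show "f \<in> ideal_generated S"
      by (simp add: sum_single_keys)
  qed
qed

lemma up_closed_plus: "up_closed E \<Longrightarrow> up_closed (E + F)"
  for E F :: "'a::comm_monoid_add set"
  unfolding up_closed_def
proof (intro strip)
  fix a b assume E: "\<forall>a\<in>E. \<forall>b. a + b \<in> E" and "a \<in> E + F"
  then obtain x y where "x \<in> E" "y \<in> F" "a = x + y"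
    by (auto elim: set_plus_elim)
  then have "a + b = (x + b) + y"
    by (simp add: ac_simps)
  moreover have "x + b \<in> E"
    using E \<open>x \<in> E\<close> by blast
  ultimately show "a + b \<in> E + F"
    using \<open>y \<in> F\<close> by (simp add: set_plus_intro)
qed

lemma UNIV_plus_up_closed: "up_closed E \<Longrightarrow> UNIV + E = E"
  for E :: "'a::comm_monoid_add set"
proof -
  assume E: "up_closed E"
  have "a + b \<in> E" if "b \<in> E" for a b
    using E that by (subst add.commute) (auto simp: up_closed_def)
  moreover have "b \<in> UNIV + E" if "b \<in> E" for b
    using set_plus_intro[of 0 UNIV b E] that by simp
  ultimately show ?thesis
    by (auto elim!: set_plus_elim)
qed

lemma ideal_generated_monomials:
  "ideal_generated (monomial ` V :: ('k::field, 'n::finite) mpolynomial set) =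
    supported_on (V + UNIV)"
proof (rule ideal_generated_eq_supported_on)
  show "up_closed (V + UNIV)"
    by (subst add.commute, intro up_closed_plus) (simp add: up_closed_def)
  have "v \<in> V + UNIV" if "v \<in> V" for v
    using set_plus_intro[of v V 0 UNIV] that by simp
  then show "(monomial ` V :: ('k, 'n) mpolynomial set) \<subseteq> supported_on (V + UNIV)"
    by (auto simp: supported_on_def monomial_def)
  fix a :: "nat ^ 'n" and c :: 'k
  assume "a \<in> V + UNIV"
  then obtain v b where v: "v \<in> V" and a: "a = v + b"
    by (auto elim: set_plus_elim)
  have "Poly_Mapping.single a c = Poly_Mapping.single b c * monomial v"
    by (simp add: a monomial_def mult_single add.commute)
  also have "\<dots> \<in> ideal_generated (monomial ` V)"
    using v unfolding ideal_generated_def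
    by (intro module.span_scale[OF module_mult] module.span_base[OF module_mult]) simp
  finally show "Poly_Mapping.single a c \<in> ideal_generated (monomial ` V)" .
qed

lemma ideal_generated_products_supported_on:
  assumes "up_closed E"
  shows "ideal_generated {x * y |x y. x \<in> supported_on E \<and> y \<in> supported_on F} =
    (supported_on (E + F) :: ('k::field, 'n::finite) mpolynomial set)"
proof (rule ideal_generated_eq_supported_on)
  show "up_closed (E + F)"
    using assms by (rule up_closed_plus)
  show "{x * y |x y. x \<in> supported_on E \<and> y \<in> supported_on F}
      \<subseteq> (supported_on (E + F) :: ('k, 'n) mpolynomial set)"
    by (auto simp: supported_on_def elim!: keys_multE intro!: set_plus_intro)
  fix a :: "nat ^ 'n" and c :: 'k
  assume "a \<in> E + F"
  then obtain x y where xy: "x \<in> E" "y \<in> F" "a = x + y"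
    by (auto elim: set_plus_elim)
  have "Poly_Mapping.single a c = Poly_Mapping.single x c * Poly_Mapping.single y 1"
    by (simp add: xy mult_single)
  moreover have "Poly_Mapping.single x c \<in> supported_on E"
    "(Poly_Mapping.single y 1 :: ('k, 'n) mpolynomial) \<in> supported_on F"
    using xy by (auto simp: supported_on_def)
  ultimately show "Poly_Mapping.single a c \<in>
      ideal_generated {x * y |x y. x \<in> supported_on E \<and> y \<in> supported_on F}"
    unfolding ideal_generated_def by (intro module.span_base[OF module_mult]) blast
qed

section \<open>Exponents of the powers of a monomial ideal\<close>

definition power_exponents :: "(nat ^ 'n::finite) set \<Rightarrow> nat \<Rightarrow> (nat ^ 'n) set" where
  "power_exponents V n =
    {a. \<exists>k. sum k V = n \<and> (\<forall>i. (\<Sum>v\<in>V. k v * v $ i) \<le> a $ i)}"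

text \<open>
  For \<open>n \<ge> 1\<close> these are the lattice points of \<open>n\<close> times the Newton polyhedron, which is the convex hull of \<open>V\<close>
  plus the nonnegative orthant.
\<close>

definition newton_exponents :: "(nat ^ 'n::finite) set \<Rightarrow> nat \<Rightarrow> (nat ^ 'n) set" where
  "newton_exponents V n =
    {a. \<exists>c. (\<forall>v\<in>V. 0 \<le> c v) \<and> sum c V = real n \<and>
          (\<forall>i. (\<Sum>v\<in>V. c v * real (v $ i)) \<le> real (a $ i))}"

lemma up_closed_power_exponents: "up_closed (power_exponents V n)"
  unfolding up_closed_def power_exponents_def
  by (auto intro: trans_le_add1)

lemma power_exponents_0: "power_exponents V 0 = UNIV"
  by (auto simp: power_exponents_def intro!: exI[of _ "\<lambda>_. 0"])

text \<open>
  This recursion makes the exponent sets follow the recursive definition of the powers of an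
  ideal.
\<close>

lemma power_exponents_Suc:
  assumes "finite V"
  shows "power_exponents V (Suc n) = (V + UNIV) + power_exponents V n"
proof (intro equalityI subsetI)
  fix a assume "a \<in> power_exponents V (Suc n)"
  then obtain k where k: "sum k V = Suc n" "\<And>i. (\<Sum>v\<in>V. k v * v $ i) \<le> a $ i"
    by (auto simp: power_exponents_def)
  obtain u where u: "u \<in> V" "k u > 0"
    using k(1) by (metis gr0I nat.distinct(1) sum.neutral)
  define k' where "k' = k(u := k u - 1)"
  have split: "(\<Sum>v\<in>V. k v * g v) = g u + (\<Sum>v\<in>V. k' v * g v)" for g :: "_ \<Rightarrow> nat"
  proof -
    have "(\<Sum>v\<in>V. k v * g v) = k u * g u + (\<Sum>v\<in>V - {u}. k v * g v)"
      using assms u(1) by (rule sum.remove)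
    moreover have "(\<Sum>v\<in>V. k' v * g v) = (k u - 1) * g u + (\<Sum>v\<in>V - {u}. k v * g v)"
      using sum.remove[OF assms u(1), of "\<lambda>v. k' v * g v"] by (simp add: k'_def)
    moreover have "k u * g u = g u + (k u - 1) * g u"
      using u(2) by (cases "k u") auto
    ultimately show ?thesis by simp
  qed
  have "sum k' V = n"
    using split[of "\<lambda>_. 1"] k(1) by simp
  moreover have le: "u $ i + (\<Sum>v\<in>V. k' v * v $ i) \<le> a $ i" for i
    using k(2)[of i] split[of "\<lambda>v. v $ i"] by simp
  moreover have "(\<Sum>v\<in>V. k' v * v $ i) \<le> (a - u) $ i" for i
    using le[of i] by simp
  ultimately have "a - u \<in> power_exponents V n"
    unfolding power_exponents_def by blast
  moreover have "a = u + (a - u)"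
    unfolding vec_eq_iff
  proof
    fix i show "a $ i = (u + (a - u)) $ i"
      using le[of i] by simp
  qed
  moreover have "u \<in> V + UNIV"
    using set_plus_intro[of u V 0 UNIV] u(1) by simp
  ultimately show "a \<in> V + UNIV + power_exponents V n"
    by (metis set_plus_intro)
next
  fix a assume "a \<in> V + UNIV + power_exponents V n"
  then obtain u b x where u: "u \<in> V" and a: "a = u + b + x" and x: "x \<in> power_exponents V n"
    by (auto elim!: set_plus_elim)
  then obtain k where k: "sum k V = n" "\<And>i. (\<Sum>v\<in>V. k v * v $ i) \<le> x $ i"
    by (auto simp: power_exponents_def)
  define k' where "k' = (\<lambda>v. k v + (if v = u then 1 else 0))"
  have split: "(\<Sum>v\<in>V. k' v * g v) = g u + (\<Sum>v\<in>V. k v * g v)" for g :: "_ \<Rightarrow> nat"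
  proof -
    have "(\<Sum>v\<in>V. k' v * g v) = (\<Sum>v\<in>V. k v * g v) + (\<Sum>v\<in>V. if v = u then g v else 0)"
      unfolding sum.distrib[symmetric] by (rule sum.cong) (auto simp: k'_def)
    then show ?thesis
      using assms u by simp
  qed
  have "sum k' V = Suc n"
    using split[of "\<lambda>_. 1"] k(1) by simp
  moreover have "(\<Sum>v\<in>V. k' v * v $ i) \<le> a $ i" for i
    using k(2)[of i] split[of "\<lambda>v. v $ i"] by (simp add: a)
  ultimately show "a \<in> power_exponents V (Suc n)"
    unfolding power_exponents_def by blast
qed

lemma power_exponents_add:
  assumes "finite V"
  shows "power_exponents V (p + q) = power_exponents V p + power_exponents V q"
proof (induction p)
  case 0
  then show ?case
    by (simp add: power_exponents_0 UNIV_plus_up_closed up_closed_power_exponents)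
next
  case (Suc p)
  then show ?case
    by (simp add: power_exponents_Suc[OF assms] add.assoc)
qed

lemma power_exponents_antimono:
  assumes "finite V" "n \<le> m"
  shows "power_exponents V m \<subseteq> power_exponents V n"
proof -
  have "power_exponents V m = power_exponents V n + power_exponents V (m - n)"
    using assms power_exponents_add[of V n "m - n"] by simp
  also have "\<dots> \<subseteq> power_exponents V n"
    using up_closed_power_exponents[of V n] by (auto simp: up_closed_def elim!: set_plus_elim)
  finally show ?thesis .
qed

text \<open>
  The case \<open>n = 1\<close> describes the powers of the ideal generated by the monomials of \<open>V\<close>. In general,
  \<open>I\<close> is the \<open>n\<close>-th of these powers, and the coefficients of an equation of integral dependence
  over \<open>I\<close> lie in powers of \<open>I\<close>.
\<close>

lemma ideal_power_supported_on:
  fixes I :: "('k::field, 'n::finite) mpolynomial set"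
  assumes "finite V" and I: "I = supported_on (power_exponents V n)"
  shows "ideal_power I i = supported_on (power_exponents V (n * i))"
proof (induction i)
  case 0
  then show ?case
    by (simp add: power_exponents_0 supported_on_def)
next
  case (Suc i)
  then show ?case
    by (simp add: I ideal_generated_products_supported_on up_closed_power_exponents
        power_exponents_add[OF assms(1)])
qed

lemma ideal_generated_monomials_eq_power_exponents:
  assumes "finite V"
  shows "ideal_generated (monomial ` V :: ('k::field, 'n::finite) mpolynomial set) =
    supported_on (power_exponents V 1)"
proof -
  have "V + UNIV + UNIV = V + (UNIV :: (nat ^ 'n) set)"
    by (simp add: add.assoc UNIV_plus_up_closed up_closed_def)
  then show ?thesis
    using power_exponents_Suc[OF assms, of 0]
    by (simp add: ideal_generated_monomials power_exponents_0)
qed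

section \<open>Extreme exponents and the integral closure\<close>

definition real_exponent :: "nat ^ 'n \<Rightarrow> real ^ 'n" where
  "real_exponent a = (\<chi> i. real (a $ i))"

lemma real_exponent_simps [simp]:
  "real_exponent a $ i = real (a $ i)"
  "real_exponent (a + b) = real_exponent a + real_exponent b"
  "real_exponent (j *s a) = real j *\<^sub>R real_exponent a"
  by (simp_all add: real_exponent_def vec_eq_iff)

lemma real_exponent_eq_iff [simp]: "real_exponent a = real_exponent b \<longleftrightarrow> a = b"
  by (auto simp: real_exponent_def vec_eq_iff)

text \<open>If only one pair of terms contributes to a coefficient of a product, nothing can cancel it.\<close>

lemma lookup_mult_unique_factorization:
  fixes f g :: "'a::comm_monoid_add \<Rightarrow>\<^sub>0 'b::comm_ring_1"
  assumes unique: "\<And>x y. x \<in> Poly_Mapping.keys f \<Longrightarrow> y \<in> Poly_Mapping.keys g \<Longrightarrow>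
      x + y = a + b \<Longrightarrow> x = a \<and> y = b"
  shows "Poly_Mapping.lookup (f * g) (a + b) = Poly_Mapping.lookup f a * Poly_Mapping.lookup g b"
proof -
  define c where "c = Poly_Mapping.lookup f a"
  define d where "d = Poly_Mapping.lookup g b"
  define f' where "f' = f - Poly_Mapping.single a c"
  define g' where "g' = g - Poly_Mapping.single b d"
  have f': "x \<in> Poly_Mapping.keys f \<and> x \<noteq> a" if "x \<in> Poly_Mapping.keys f'" for x
    using that by (auto simp: f'_def c_def in_keys_iff lookup_minus lookup_single when_def split: if_splits)
  have g': "x \<in> Poly_Mapping.keys g \<and> x \<noteq> b" if "x \<in> Poly_Mapping.keys g'" for x
    using that by (auto simp: g'_def d_def in_keys_iff lookup_minus lookup_single when_def split: if_splits)
  have "f * g = Poly_Mapping.single (a + b) (c * d) + Poly_Mapping.single a c * g' + f' * g"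
    by (simp add: f'_def g'_def algebra_simps mult_single)
  moreover have "Poly_Mapping.lookup (f' * g) (a + b) = 0"
  proof (rule ccontr)
    assume "Poly_Mapping.lookup (f' * g) (a + b) \<noteq> 0"
    then have "a + b \<in> Poly_Mapping.keys (f' * g)"
      by (simp add: in_keys_iff)
    then obtain x y where "a + b = x + y" "x \<in> Poly_Mapping.keys f'" "y \<in> Poly_Mapping.keys g"
      by (rule keys_multE)
    then show False
      using f'[of x] unique[of x y] by simp
  qed
  moreover have "Poly_Mapping.lookup (Poly_Mapping.single a c * g') (a + b) = 0"
  proof (rule ccontr)
    assume "Poly_Mapping.lookup (Poly_Mapping.single a c * g') (a + b) \<noteq> 0"
    then have "a + b \<in> Poly_Mapping.keys (Poly_Mapping.single a c * g')"
      by (simp add: in_keys_iff)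
    then obtain x y where "a + b = x + y" "x \<in> Poly_Mapping.keys (Poly_Mapping.single a c)"
      "y \<in> Poly_Mapping.keys g'"
      by (rule keys_multE)
    then show False
      using g'[of y] unique[of x y] by (auto simp: c_def in_keys_iff split: if_splits)
  qed
  ultimately show ?thesis
    by (simp add: lookup_add c_def d_def)
qed

text \<open>
  Every linear functional \<open>w\<close> is minimized over the exponents of \<open>f\<close> at a vertex \<open>a\<close> of the Newton
  polytope, and a multiple \<open>j a\<close> of a vertex is a sum of \<open>j\<close> exponents in one way only.
  Hence the corresponding term of \<open>f ^ j\<close> survives. Among several minimizers of \<open>w\<close> one
  of largest Euclidean norm is a vertex: by strict convexity of the norm, every other minimizer
  has a strictly smaller inner product with it.
\<close>

lemma extreme_exponent:
  fixes f :: "('k::field, 'n::finite) mpolynomial" and w :: "real ^ 'n"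
  assumes "f \<noteq> 0"
  obtains a where "a \<in> Poly_Mapping.keys f"
    and "\<And>x. x \<in> Poly_Mapping.keys f \<Longrightarrow> w \<bullet> real_exponent a \<le> w \<bullet> real_exponent x"
    and "\<And>j x. x \<in> Poly_Mapping.keys (f ^ j) \<Longrightarrow>
      real j * (w \<bullet> real_exponent a) \<le> w \<bullet> real_exponent x"
    and "\<And>j. j *s a \<in> Poly_Mapping.keys (f ^ j)"
proof -
  let ?K = "Poly_Mapping.keys f"
  let ?W = "\<lambda>x. w \<bullet> real_exponent x"
  define T where "T = {x \<in> ?K. \<forall>y\<in>?K. ?W x \<le> ?W y}"
  have "finite ?K" "?K \<noteq> {}"
    using assms by auto
  then have "T \<noteq> {}"
    unfolding T_def using ex_min_if_finite[of "?W ` ?K"] by fastforce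
  moreover have "finite T"
    by (simp add: T_def)
  ultimately obtain a where aT: "a \<in> T"
    and amax: "\<And>x. x \<in> T \<Longrightarrow> norm (real_exponent x) \<le> norm (real_exponent a)"
    using obtains_MAX[of T "\<lambda>x. norm (real_exponent x)"]
    by (metis Max_ge finite_imageI image_eqI)
  let ?N = "\<lambda>x. real_exponent x \<bullet> real_exponent a"
  have a: "a \<in> ?K" and amin: "\<And>x. x \<in> ?K \<Longrightarrow> ?W a \<le> ?W x"
    using aT by (auto simp: T_def)
  have strict: "?N x < ?N a" if "x \<in> ?K" "?W x = ?W a" "x \<noteq> a" for x
  proof -
    have "x \<in> T"
      using that a amin by (simp add: T_def)
    then have "real_exponent x \<bullet> real_exponent x \<le> ?N a"
      using amax[of x] by (simp add: norm_le)
    moreover have "0 < (real_exponent x - real_exponent a) \<bullet> (real_exponent x - real_exponent a)"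
      using that(3) by (simp del: inner_diff_left inner_diff_right)
    ultimately show ?thesis
      by (simp add: inner_diff inner_commute)
  qed
  \<comment> \<open>Among the exponents of \<open>f ^ j\<close>, \<open>j *s a\<close> is the unique one that minimizes \<open>w\<close> and then
    maximizes the inner product with \<open>a\<close>.\<close>
  have pow: "(\<forall>y\<in>Poly_Mapping.keys (f ^ j). real j * ?W a \<le> ?W y \<and>
      (?W y = real j * ?W a \<longrightarrow> ?N y \<le> real j * ?N a \<and> (?N y = real j * ?N a \<longrightarrow> y = j *s a))) \<and>
      j *s a \<in> Poly_Mapping.keys (f ^ j)" for j
  proof (induction j)
    case 0
    have "real_exponent (0 :: nat ^ 'n) = 0" "0 *s a = 0"
      by (simp_all add: vec_eq_iff)
    then show ?case
      by simp
  next
    case (Suc j)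
    let ?L = "Poly_Mapping.keys (f ^ j)"
    have smult: "Suc j *s a = a + j *s a"
      by (simp add: vec_eq_iff)
    have IH: "real j * ?W a \<le> ?W z"
      "?W z = real j * ?W a \<Longrightarrow> ?N z \<le> real j * ?N a"
      "?W z = real j * ?W a \<Longrightarrow> ?N z = real j * ?N a \<Longrightarrow> z = j *s a"
      if "z \<in> ?L" for z
      using Suc that by auto
    have step: "real (Suc j) * ?W a \<le> ?W (x + z)"
      "?W (x + z) = real (Suc j) * ?W a \<Longrightarrow> ?N (x + z) \<le> real (Suc j) * ?N a"
      "?W (x + z) = real (Suc j) * ?W a \<Longrightarrow> ?N (x + z) = real (Suc j) * ?N a \<Longrightarrow>
        x = a \<and> z = j *s a"
      if x: "x \<in> ?K" and z: "z \<in> ?L" for x z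
    proof -
      show "real (Suc j) * ?W a \<le> ?W (x + z)"
        using amin[OF x] IH(1)[OF z] by (simp add: inner_add algebra_simps)
      assume "?W (x + z) = real (Suc j) * ?W a"
      then have W: "?W x = ?W a" "?W z = real j * ?W a"
        using amin[OF x] IH(1)[OF z] by (simp_all add: inner_add algebra_simps)
      show "?N (x + z) \<le> real (Suc j) * ?N a"
        using strict[OF x W(1)] IH(2)[OF z W(2)]
        by (cases "x = a") (simp_all add: inner_add algebra_simps)
      assume N: "?N (x + z) = real (Suc j) * ?N a"
      have "x = a"
        using N strict[OF x W(1)] IH(2)[OF z W(2)]
        by (cases "x = a") (simp_all add: inner_add algebra_simps)
      then show "x = a \<and> z = j *s a"
        using N IH(3)[OF z W(2)] by (simp add: inner_add algebra_simps)
    qed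
    have "Poly_Mapping.lookup (f * f ^ j) (a + j *s a) =
        Poly_Mapping.lookup f a * Poly_Mapping.lookup (f ^ j) (j *s a)"
    proof (rule lookup_mult_unique_factorization)
      fix x y assume "x \<in> ?K" "y \<in> ?L" and eq: "x + y = a + j *s a"
      moreover have "?W (x + y) = real (Suc j) * ?W a" "?N (x + y) = real (Suc j) * ?N a"
        unfolding eq by (simp_all add: inner_add algebra_simps)
      ultimately show "x = a \<and> y = j *s a"
        using step(3) by blast
    qed
    moreover have "\<dots> \<noteq> 0"
      using a Suc by (simp add: in_keys_iff)
    ultimately have "Suc j *s a \<in> Poly_Mapping.keys (f ^ Suc j)"
      by (simp add: smult in_keys_iff)
    moreover have "real (Suc j) * ?W a \<le> ?W y \<and>
      (?W y = real (Suc j) * ?W a \<longrightarrow>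
        ?N y \<le> real (Suc j) * ?N a \<and> (?N y = real (Suc j) * ?N a \<longrightarrow> y = Suc j *s a))"
      if y: "y \<in> Poly_Mapping.keys (f ^ Suc j)" for y
    proof -
      from y obtain x z where "y = x + z" "x \<in> ?K" "z \<in> ?L"
        unfolding power_Suc by (rule keys_multE)
      then show ?thesis
        using step[of x z] unfolding smult by blast
    qed
    ultimately show ?case by blast
  qed
  show thesis
    using that[OF a amin] pow by blast
qed

text \<open>
  The real points above the convex hull of the scaled exponents form a closed convex set \<open>Q\<close>,
  a compact polytope plus the closed orthant, that does not contain \<open>a\<close>. If \<open>x\<close> is an exponent of
  \<open>(I\<^sup>n)\<^sup>i\<close>, then \<open>x / i\<close> lies in \<open>Q\<close>, so a hyperplane separating \<open>a\<close> from \<open>Q\<close> bounds the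
  exponents of all these powers at once.
\<close>

lemma newton_separation:
  assumes "finite V" "n \<ge> 1" "a \<notin> newton_exponents V n"
  obtains w :: "real ^ 'n::finite" and b :: real
  where "w \<bullet> real_exponent a < b"
    and "\<And>i x. i \<ge> 1 \<Longrightarrow> x \<in> power_exponents V (n * i) \<Longrightarrow> real i * b < w \<bullet> real_exponent x"
proof -
  define h where "h = (\<lambda>v::nat ^ 'n. real n *\<^sub>R real_exponent v)"
  define Q where "Q = (\<Union>x\<in>convex hull (h ` V). \<Union>y\<in>{y. \<forall>i. 0 \<le> y $ i}. {x + y})"
  have inj: "inj_on h V"
    using assms(2) by (auto simp: inj_on_def h_def)
  have "convex {y::real ^ 'n. \<forall>i. 0 \<le> y $ i}"
    by (simp add: convex_def)
  then have "convex Q"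
    unfolding Q_def by (intro convex_sums convex_convex_hull)
  moreover have "closed Q"
    unfolding Q_def using assms(1)
    by (intro compact_closed_sums finite_imp_compact_convex_hull closed_positive_orthant) simp
  moreover have "real_exponent a \<notin> Q"
  proof
    assume "real_exponent a \<in> Q"
    then obtain x y where x: "x \<in> convex hull (h ` V)" and y: "\<And>i. 0 \<le> y $ i"
      and axy: "real_exponent a = x + y"
      by (auto simp: Q_def)
    obtain u where u: "\<And>s. s \<in> h ` V \<Longrightarrow> 0 \<le> u s" "sum u (h ` V) = 1"
      "(\<Sum>s\<in>h ` V. u s *\<^sub>R s) = x"
      using x assms(1) by (auto simp: convex_hull_finite)
    define c where "c = (\<lambda>v. u (h v) * real n)"
    have "sum c V = real n"
      using u(2) inj by (simp add: c_def sum.reindex flip: sum_distrib_right)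
    moreover have "0 \<le> c v" if "v \<in> V" for v
      using u(1) that by (simp add: c_def)
    moreover have "(\<Sum>v\<in>V. c v * real (v $ i)) \<le> real (a $ i)" for i
    proof -
      have "(\<Sum>v\<in>V. c v * real (v $ i)) = x $ i"
        using u(3) inj by (auto simp: sum.reindex c_def h_def mult.assoc)
      moreover have "real (a $ i) = x $ i + y $ i"
        using arg_cong[OF axy, of "\<lambda>z. z $ i"] by simp
      ultimately show ?thesis
        using y[of i] by simp
    qed
    ultimately have "a \<in> newton_exponents V n"
      unfolding newton_exponents_def by blast
    then show False
      using assms(3) by simp
  qed
  ultimately obtain w b where w: "w \<bullet> real_exponent a < b" "\<And>x. x \<in> Q \<Longrightarrow> b < w \<bullet> x"
    using separating_hyperplane_closed_point[of Q "real_exponent a"] by blast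
  have "real i * b < w \<bullet> real_exponent x" if i: "i \<ge> 1" and x: "x \<in> power_exponents V (n * i)" for i x
  proof -
    obtain k where k: "sum k V = n * i" "\<And>j. (\<Sum>v\<in>V. k v * v $ j) \<le> x $ j"
      using x by (auto simp: power_exponents_def)
    define c where "c = (\<lambda>v. real (k v) / real (n * i))"
    define z where "z = (\<Sum>v\<in>V. c v *\<^sub>R h v)"
    have "sum c V = 1"
      using assms(2) i by (simp add: c_def k(1) flip: sum_divide_distrib of_nat_sum)
    then have "z \<in> convex hull (h ` V)"
      unfolding z_def using assms(1)
      by (intro convex_sum convex_convex_hull) (auto simp: c_def intro: hull_inc)
    moreover have "0 \<le> ((1 / real i) *\<^sub>R real_exponent x - z) $ j" for j
    proof -
      have "z $ j = real (\<Sum>v\<in>V. k v * v $ j) / real i"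
        using assms(2) i by (simp add: z_def c_def h_def sum_divide_distrib field_simps)
      also have "\<dots> \<le> real (x $ j) / real i"
        by (intro divide_right_mono) (use k(2) in \<open>simp_all only: of_nat_le_iff of_nat_0_le_iff\<close>)
      finally show ?thesis by simp
    qed
    moreover have "(1 / real i) *\<^sub>R real_exponent x = z + ((1 / real i) *\<^sub>R real_exponent x - z)"
      by simp
    ultimately have "(1 / real i) *\<^sub>R real_exponent x \<in> Q"
      unfolding Q_def by blast
    then show ?thesis
      using w(2)[of "(1 / real i) *\<^sub>R real_exponent x"] i by (simp add: field_simps)
  qed
  with w(1) show thesis
    by (rule that)
qed

text \<open>
  Suppose \<open>w\<close> separates an exponent of \<open>f\<close> from the Newton polyhedron at level \<open>b\<close>, and let \<open>e\<close> be
  an exponent of \<open>f\<close> as in \<open>extreme_exponent\<close>, so that its weight is less than \<open>b\<close>. The term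
  \<open>m e\<close> of \<open>f ^ m\<close> has weight \<open>m (w \<bullet> e)\<close>, while every term of \<open>g i * f ^ (m - i)\<close> has weight
  larger than \<open>i b + (m - i) (w \<bullet> e)\<close>; so it cannot be cancelled.
\<close>

lemma keys_integral_closure_subset:
  fixes f :: "('k::field, 'n::finite) mpolynomial"
  assumes "finite V" "n \<ge> 1"
    and f: "f \<in> integral_closure (supported_on (power_exponents V n))"
  shows "Poly_Mapping.keys f \<subseteq> newton_exponents V n"
proof (rule ccontr)
  assume "\<not> ?thesis"
  then obtain a where a: "a \<in> Poly_Mapping.keys f" "a \<notin> newton_exponents V n"
    by blast
  obtain w b where w: "w \<bullet> real_exponent a < b"
    "\<And>i x. i \<ge> 1 \<Longrightarrow> x \<in> power_exponents V (n * i) \<Longrightarrow> real i * b < w \<bullet> real_exponent x"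
    using newton_separation[OF assms(1,2) a(2)] by metis
  have "f \<noteq> 0"
    using a(1) by auto
  from extreme_exponent[OF this, of w] obtain e where
    e: "w \<bullet> real_exponent e \<le> w \<bullet> real_exponent a"
    and e_pow: "\<And>j x. x \<in> Poly_Mapping.keys (f ^ j) \<Longrightarrow>
      real j * (w \<bullet> real_exponent e) \<le> w \<bullet> real_exponent x"
    and e_key: "\<And>j. j *s e \<in> Poly_Mapping.keys (f ^ j)"
    using a(1) by metis
  obtain m g where g: "\<And>i. i \<in> {1..m} \<Longrightarrow> g i \<in> ideal_power (supported_on (power_exponents V n)) i"
    and eq: "f ^ m + (\<Sum>i=1..m. g i * f ^ (m - i)) = 0"
    using f unfolding integral_closure_def by blast
  have "Poly_Mapping.lookup (f ^ m) (m *s e) \<noteq> 0"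
    using e_key by (simp add: in_keys_iff)
  moreover have "f ^ m = - (\<Sum>i=1..m. g i * f ^ (m - i))"
    using eq by (simp add: eq_neg_iff_add_eq_0)
  ultimately have "(\<Sum>i=1..m. Poly_Mapping.lookup (g i * f ^ (m - i)) (m *s e)) \<noteq> 0"
    by (simp add: lookup_sum)
  then obtain i where i: "i \<in> {1..m}" "m *s e \<in> Poly_Mapping.keys (g i * f ^ (m - i))"
    by (meson in_keys_iff sum.neutral)
  then obtain x y where xy: "m *s e = x + y" "x \<in> Poly_Mapping.keys (g i)"
    "y \<in> Poly_Mapping.keys (f ^ (m - i))"
    by (blast elim: keys_multE)
  have "x \<in> power_exponents V (n * i)"
    using g[OF i(1)] xy(2) ideal_power_supported_on[OF assms(1) refl, of n i, where 'k = 'k]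
    by (auto simp: supported_on_def)
  then have "real i * b < w \<bullet> real_exponent x"
    using w(2) i(1) by simp
  moreover have "real (m - i) * (w \<bullet> real_exponent e) \<le> w \<bullet> real_exponent y"
    using e_pow xy(3) by blast
  moreover have "real m * (w \<bullet> real_exponent e) = w \<bullet> real_exponent x + w \<bullet> real_exponent y"
    using arg_cong[OF xy(1), of "\<lambda>z. w \<bullet> real_exponent z"] by (simp add: inner_add)
  moreover have "real (m - i) * (w \<bullet> real_exponent e) =
      real m * (w \<bullet> real_exponent e) - real i * (w \<bullet> real_exponent e)"
    using i(1) by (simp add: of_nat_diff left_diff_distrib)
  ultimately have "real i * b < real i * (w \<bullet> real_exponent e)"
    by linarith
  then have "b < w \<bullet> real_exponent e"
    using i(1) by simp
  then show False
    using e w(1) by simp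
qed

text \<open>
  The weights \<open>c v\<close> may be irrational. Multiplied by a suitable \<open>q\<close>, they are all within
  \<open>1 / M\<close> of integers \<open>r v\<close>. Passing from \<open>q * c v\<close> to \<open>r v\<close>
  changes the total weight and the coordinates of the combination by less than 1. The equation for
  the weight and the bounds for the coordinates are then relations between integers that hold up to
  an error less than 1, so they hold exactly.
\<close>

lemma newton_exponents_multiple:
  assumes "finite V" "a \<in> newton_exponents V n"
  obtains q where "q \<ge> 1" "q *s a \<in> power_exponents V (n * q)"
proof -
  obtain c where c: "\<And>v. v \<in> V \<Longrightarrow> 0 \<le> c v" "sum c V = real n"
    "\<And>i. (\<Sum>v\<in>V. c v * real (v $ i)) \<le> real (a $ i)"
    using assms(2) by (auto simp: newton_exponents_def)
  \<comment> \<open>The summand 1 controls the total weight, the coordinate sum each single coordinate.\<close>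
  define M where "M = Suc (\<Sum>v\<in>V. 1 + (\<Sum>i\<in>UNIV. v $ i))"
  obtain h where h: "bij_betw h V {0..<card V}"
    using ex_bij_betw_finite_nat[OF assms(1)] by blast
  define \<theta> where "\<theta> = (\<lambda>j. c (inv_into V h j))"
  have "M > 0"
    by (simp add: M_def)
  obtain q p where "0 < q" and p: "\<And>j. j < card V \<Longrightarrow> \<bar>real_of_int q * \<theta> j - real_of_int (p j)\<bar> < 1 / real M"
    by (rule Dirichlet_approx_simult[OF \<open>M > 0\<close>, where n = "card V" and \<theta> = \<theta>]) blast
  define r where "r = (\<lambda>v. p (h v))"
  have close: "\<bar>real_of_int q * c v - real_of_int (r v)\<bar> < 1 / real M" if "v \<in> V" for v
  proof -
    have "h v < card V" "inv_into V h (h v) = v"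
      using h that by (auto simp: bij_betw_def)
    then show ?thesis
      using p[of "h v"] by (simp add: \<theta>_def r_def)
  qed
  have r_nonneg: "0 \<le> r v" if "v \<in> V" for v
  proof -
    have "0 \<le> real_of_int q * c v"
      using \<open>0 < q\<close> c(1)[OF that] by simp
    moreover have "1 / real M \<le> 1"
      using \<open>M > 0\<close> by simp
    ultimately have "- 1 < real_of_int (r v)"
      using close[OF that] by linarith
    then show ?thesis by linarith
  qed
  \<comment> \<open>Used for \<open>g v = 1\<close> and for \<open>g v = v $ i\<close>.\<close>
  have weighted: "\<bar>(\<Sum>v\<in>V. (real_of_int q * c v - real_of_int (r v)) * real (g v))\<bar> < 1"
    if g: "\<And>v. v \<in> V \<Longrightarrow> g v \<le> 1 + (\<Sum>i\<in>UNIV. v $ i)" for g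
  proof -
    have "\<bar>(\<Sum>v\<in>V. (real_of_int q * c v - real_of_int (r v)) * real (g v))\<bar>
        \<le> (\<Sum>v\<in>V. \<bar>(real_of_int q * c v - real_of_int (r v)) * real (g v)\<bar>)"
      by (rule sum_abs)
    also have "\<dots> \<le> (\<Sum>v\<in>V. 1 / real M * real (1 + (\<Sum>i\<in>UNIV. v $ i)))"
    proof (rule sum_mono)
      fix v assume v: "v \<in> V"
      have "real (g v) \<le> real (1 + (\<Sum>i\<in>UNIV. v $ i))"
        using g[OF v] by (simp only: of_nat_le_iff)
      then show "\<bar>(real_of_int q * c v - real_of_int (r v)) * real (g v)\<bar>
          \<le> 1 / real M * real (1 + (\<Sum>i\<in>UNIV. v $ i))"
        unfolding abs_mult abs_of_nat using close[OF v] by (intro mult_mono) simp_all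
    qed
    also have "\<dots> = real (\<Sum>v\<in>V. 1 + (\<Sum>i\<in>UNIV. v $ i)) / real M"
      by (simp only: of_nat_sum sum_distrib_left[symmetric]) simp
    also have "\<dots> < 1"
    proof -
      have "real s / real (Suc s) < 1" for s
        by (simp add: divide_less_eq)
      then show ?thesis
        by (simp only: M_def)
    qed
    finally show ?thesis .
  qed
  define k where "k = (\<lambda>v. nat (r v))"
  have k: "real_of_int (r v) = real (k v)" if "v \<in> V" for v
    using r_nonneg[OF that] by (simp add: k_def)
  have q: "real_of_int q = real (nat q)"
    using \<open>0 < q\<close> by simp
  have diff: "(\<Sum>v\<in>V. (real_of_int q * c v - real_of_int (r v)) * real (g v)) =
      real (nat q) * (\<Sum>v\<in>V. c v * real (g v)) - real (\<Sum>v\<in>V. k v * g v)" for g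
    unfolding q using k by (simp add: left_diff_distrib sum_subtractf sum_distrib_left mult.assoc)
  have "sum k V = n * nat q"
  proof -
    have "\<bar>real (n * nat q) - real (sum k V)\<bar> < 1"
      using weighted[of "\<lambda>_. 1"] diff[of "\<lambda>_. 1"] c(2) by (simp add: mult.commute)
    then show ?thesis by linarith
  qed
  moreover have "(\<Sum>v\<in>V. k v * v $ i) \<le> (nat q *s a) $ i" for i
  proof -
    have "v $ i \<le> 1 + (\<Sum>i\<in>UNIV. v $ i)" for v :: "nat ^ 'a"
      by (intro trans_le_add2 member_le_sum) auto
    then have "\<bar>real (nat q) * (\<Sum>v\<in>V. c v * real (v $ i)) - real (\<Sum>v\<in>V. k v * v $ i)\<bar> < 1"
      using weighted[of "\<lambda>v. v $ i"] diff[of "\<lambda>v. v $ i"] by simp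
    moreover have "real (nat q) * (\<Sum>v\<in>V. c v * real (v $ i)) \<le> real (nat q) * real (a $ i)"
      using c(3) by (intro mult_left_mono) auto
    ultimately have "real (\<Sum>v\<in>V. k v * v $ i) < real (nat q * a $ i) + 1"
      by simp
    then show ?thesis
      by (simp only: vector_smult_component)
  qed
  ultimately have "nat q *s a \<in> power_exponents V (n * nat q)"
    unfolding power_exponents_def by blast
  moreover have "nat q \<ge> 1"
    using \<open>0 < q\<close> by simp
  ultimately show thesis
    by (rule that[rotated])
qed

lemma monomial_power: "monomial a ^ q = monomial (q *s a)"
proof (induction q)
  case 0
  have "0 *s a = 0" by (simp add: vec_eq_iff)
  then show ?case by (simp add: monomial_def)
next
  case (Suc q)
  have "Suc q *s a = a + q *s a" by (simp add: vec_eq_iff)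
  then show ?case using Suc by (simp add: monomial_def mult_single)
qed

lemma root_mem_integral_closure:
  fixes f :: "'a::comm_ring_1"
  assumes "q \<ge> 1" "- (f ^ q) \<in> ideal_power J q" "\<And>i. 0 \<in> ideal_power J i"
  shows "f \<in> integral_closure J"
  unfolding integral_closure_def
proof (intro CollectI exI conjI)
  define a where "a = (\<lambda>i. if i = q then - (f ^ q) else 0)"
  show "q \<ge> 1" by fact
  show "\<forall>i\<in>{1..q}. a i \<in> ideal_power J i"
    using assms by (simp add: a_def)
  have "(\<Sum>i=1..q. a i * f ^ (q - i)) = (\<Sum>i=1..q. if i = q then - (f ^ q) else 0)"
    by (rule sum.cong) (auto simp: a_def)
  then show "f ^ q + (\<Sum>i=1..q. a i * f ^ (q - i)) = 0"
    using assms(1) by simp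
qed

lemma monomial_mem_integral_closure:
  assumes "finite V" "a \<in> newton_exponents V n"
  shows "(monomial a :: ('k::field, 'n::finite) mpolynomial) \<in>
    integral_closure (supported_on (power_exponents V n))"
proof -
  obtain q where q: "q \<ge> 1" "q *s a \<in> power_exponents V (n * q)"
    using newton_exponents_multiple[OF assms] by blast
  note power = ideal_power_supported_on[OF assms(1) refl, of n, where 'k = 'k]
  show ?thesis
  proof (rule root_mem_integral_closure)
    show "q \<ge> 1" by fact
    show "- (monomial a ^ q) \<in>
        ideal_power (supported_on (power_exponents V n) :: ('k, 'n) mpolynomial set) q"
      using q(2) unfolding power monomial_power
      by (simp add: supported_on_def monomial_def flip: single_uminus)
    show "0 \<in> ideal_power (supported_on (power_exponents V n) :: ('k, 'n) mpolynomial set) i" for i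
      unfolding power by (simp add: supported_on_def)
  qed
qed

lemma subset_integral_closure:
  fixes J :: "'a::comm_ring_1 set"
  assumes "module.subspace (*) J"
  shows "J \<subseteq> integral_closure J"
proof
  fix f assume f: "f \<in> J"
  have sub: "f \<in> ideal_generated S" if "f \<in> S" for f :: 'a and S
    unfolding ideal_generated_def by (rule module.span_base[OF module_mult that])
  have zero: "0 \<in> ideal_power J i" for i
    by (cases i) (simp_all add: ideal_generated_def module.span_zero[OF module_mult])
  have "- f \<in> J"
    by (rule module.subspace_neg[OF module_mult assms f])
  then have "(- f) * 1 \<in> {x * y |x y. x \<in> J \<and> y \<in> ideal_power J 0}"
    unfolding ideal_power.simps by blast
  then have "- f \<in> ideal_power J 1"
    unfolding One_nat_def ideal_power.simps(2) mult_1_right by (rule sub)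
  then show "f \<in> integral_closure J"
    using zero by (intro root_mem_integral_closure[of 1]) simp_all
qed

text \<open>
  The integral closure of \<open>I\<^sup>n\<close> is not computed: an upper bound for its exponents and membership
  of the monomials in the Newton polyhedron suffice for the equivalence.
\<close>

theorem normal_ideal_iff_newton_exponents:
  fixes V :: "(nat ^ 'n::finite) set"
  assumes "finite V"
  shows "normal_ideal (ideal_generated (monomial ` V :: ('k::field, 'n) mpolynomial set)) \<longleftrightarrow>
    (\<forall>n\<ge>1. newton_exponents V n \<subseteq> power_exponents V n)"
proof -
  let ?J = "\<lambda>n. supported_on (power_exponents V n) :: ('k, 'n) mpolynomial set"
  have power: "ideal_power (ideal_generated (monomial ` V)) n = ?J n" for n
    using ideal_power_supported_on[OF assms ideal_generated_monomials_eq_power_exponents[OF assms]]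
    by simp
  have "?J n = integral_closure (?J n) \<longleftrightarrow> newton_exponents V n \<subseteq> power_exponents V n"
    if n: "n \<ge> 1" for n
  proof
    assume closed: "?J n = integral_closure (?J n)"
    show "newton_exponents V n \<subseteq> power_exponents V n"
    proof
      fix a assume "a \<in> newton_exponents V n"
      then have "(monomial a :: ('k, 'n) mpolynomial) \<in> ?J n"
        using monomial_mem_integral_closure[OF assms] closed by blast
      then show "a \<in> power_exponents V n"
        by (simp add: supported_on_def monomial_def)
    qed
  next
    assume "newton_exponents V n \<subseteq> power_exponents V n"
    then have "integral_closure (?J n) \<subseteq> ?J n"
      using keys_integral_closure_subset[OF assms n] by (fastforce simp: supported_on_def)
    moreover have "?J n \<subseteq> integral_closure (?J n)"
      by (intro subset_integral_closure subspace_supported_on up_closed_power_exponents)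
    ultimately show "?J n = integral_closure (?J n)" by blast
  qed
  then show ?thesis
    by (auto simp: normal_ideal_def power)
qed

section \<open>The Hilbert basis condition\<close>

text \<open>
  Indexing the vectors by a disjoint sum splits a combination of them into the three families.
\<close>

fun ehrhart_vector :: "'n option + (nat ^ 'n) \<Rightarrow> real ^ 'n::finite option" where
  "ehrhart_vector (Inl None) = axis None 1"
| "ehrhart_vector (Inl (Some i)) = axis (Some i) 1 + axis None 1"
| "ehrhart_vector (Inr v) = lift_exponent v"

lemma lift_exponent_nth [simp]:
  "lift_exponent v $ None = 1" "lift_exponent v $ Some i = real (v $ i)"
  by (simp_all add: lift_exponent_def)

lemma ehrhart_vectors_eq: "ehrhart_vectors V = ehrhart_vector ` (UNIV <+> V)"
  unfolding ehrhart_vectors_def Plus_def image_Un image_image UNIV_option_conv image_insert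
  by (auto simp: image_iff)

text \<open>
  The sum of all coordinates but the last is 0, 1 and 2 on the three families, so these
  do not overlap.
\<close>

lemma inj_on_ehrhart_vector:
  assumes "\<forall>v\<in>V. monomial_degree v = 2"
  shows "inj_on ehrhart_vector (UNIV <+> V)"
proof (rule inj_onI)
  define d where "d = (\<lambda>x::real ^ 'a option. \<Sum>i\<in>UNIV. x $ Some i)"
  have d: "d (ehrhart_vector (Inl None)) = 0" "d (ehrhart_vector (Inl (Some i))) = 1" for i
    by (simp_all add: d_def axis_def)
  have dv: "d (ehrhart_vector (Inr v)) = 2" if "v \<in> V" for v
    using assms that by (simp add: d_def monomial_degree_def flip: of_nat_sum)
  have e: "ehrhart_vector (Inl (Some i)) $ Some j = (if i = j then 1 else 0)" for i j :: 'a
    by (simp add: axis_def)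
  have l: "v = u" if "lift_exponent v = lift_exponent u" for u v :: "nat ^ 'a"
    using arg_cong[OF that, of "\<lambda>x. x $ Some _"] by (simp add: vec_eq_iff)
  fix x y assume x: "x \<in> UNIV <+> V" and y: "y \<in> UNIV <+> V"
    and eq: "ehrhart_vector x = ehrhart_vector y"
  have deq: "d (ehrhart_vector x) = d (ehrhart_vector y)"
    using eq by simp
  show "x = y"
  proof (cases x)
    case x': (Inr u)
    then have "u \<in> V" using x by auto
    show ?thesis
    proof (cases y)
      case (Inl o')
      then show ?thesis
        using deq d dv[OF \<open>u \<in> V\<close>] x' by (cases o') (simp_all del: ehrhart_vector.simps)
    next
      case (Inr v)
      then show ?thesis using eq x' l by simp
    qed
  next
    case x': (Inl o1)
    show ?thesis
    proof (cases y)
      case (Inr v)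
      then have "v \<in> V" using y by auto
      then show ?thesis
        using deq d dv Inr x' by (cases o1) (simp_all del: ehrhart_vector.simps)
    next
      case y': (Inl o2)
      show ?thesis
      proof (cases o1)
        case None
        then show ?thesis
          using deq d x' y' by (cases o2) (simp_all del: ehrhart_vector.simps)
      next
        case i: (Some i)
        show ?thesis
        proof (cases o2)
          case None
          then show ?thesis
            using deq d x' y' i by (simp del: ehrhart_vector.simps)
        next
          case (Some j)
          then have "ehrhart_vector (Inl (Some i)) $ Some i = ehrhart_vector (Inl (Some j)) $ Some i"
            using eq x' y' i by simp
          then show ?thesis
            using e x' y' i Some by (simp split: if_splits del: ehrhart_vector.simps)
        qed
      qed
    qed
  qed
qed

lemma sum_option: "(\<Sum>x\<in>UNIV. g x) = g None + (\<Sum>i\<in>UNIV. g (Some i))"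
  for g :: "'a::finite option \<Rightarrow> 'b::comm_monoid_add"
  by (simp add: UNIV_option_conv sum.reindex)

lemma sum_ehrhart_vectors:
  fixes c :: "real ^ 'n::finite option \<Rightarrow> real"
  assumes "finite V" "\<forall>v\<in>V. monomial_degree v = 2"
  shows "(\<Sum>b\<in>ehrhart_vectors V. c b *\<^sub>R b) = x \<longleftrightarrow>
    (\<forall>i. x $ Some i = c (ehrhart_vector (Inl (Some i))) +
        (\<Sum>v\<in>V. c (ehrhart_vector (Inr v)) * real (v $ i))) \<and>
    x $ None = c (ehrhart_vector (Inl None)) + (\<Sum>i\<in>UNIV. c (ehrhart_vector (Inl (Some i)))) +
        (\<Sum>v\<in>V. c (ehrhart_vector (Inr v)))"
proof -
  let ?h = "ehrhart_vector :: 'n option + (nat ^ 'n) \<Rightarrow> _"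
  have "(\<Sum>b\<in>ehrhart_vectors V. c b *\<^sub>R b) = (\<Sum>j\<in>UNIV <+> V. c (?h j) *\<^sub>R ?h j)"
    unfolding ehrhart_vectors_eq using inj_on_ehrhart_vector[OF assms(2)]
    by (simp add: sum.reindex)
  also have "\<dots> = c (?h (Inl None)) *\<^sub>R ?h (Inl None) +
      (\<Sum>i\<in>UNIV. c (?h (Inl (Some i))) *\<^sub>R ?h (Inl (Some i))) +
      (\<Sum>v\<in>V. c (?h (Inr v)) *\<^sub>R ?h (Inr v))" (is "_ = ?S")
    using assms(1) by (simp add: sum.Plus sum_option del: ehrhart_vector.simps)
  finally have S: "(\<Sum>b\<in>ehrhart_vectors V. c b *\<^sub>R b) = ?S" .
  have S_Some: "?S $ Some i = c (?h (Inl (Some i))) + (\<Sum>v\<in>V. c (?h (Inr v)) * real (v $ i))" for i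
  proof -
    have "(\<Sum>j\<in>UNIV. c (?h (Inl (Some j))) * ?h (Inl (Some j)) $ Some i) =
        (\<Sum>j\<in>UNIV. if j = i then c (?h (Inl (Some i))) else 0)"
      by (rule sum.cong) (auto simp: axis_def)
    then show ?thesis
      by (simp add: axis_def)
  qed
  have S_None: "?S $ None = c (?h (Inl None)) + (\<Sum>i\<in>UNIV. c (?h (Inl (Some i)))) +
      (\<Sum>v\<in>V. c (?h (Inr v)))"
    by (simp add: axis_def)
  show ?thesis
    unfolding S vec_eq_iff split_option_all S_Some S_None
    by (simp only: eq_commute[of _ "x $ _"] conj_commute)
qed

text \<open>
  Cone and semigroup are defined by coefficient functions on the set of vectors itself. As the
  vectors are distinct, their coefficients can be prescribed family by family.
\<close>

lemma ex_coefficients_on_ehrhart_vectors: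
  fixes \<nu> :: 'c and \<mu> :: "'n::finite \<Rightarrow> 'c" and \<kappa> :: "nat ^ 'n \<Rightarrow> 'c"
  assumes "\<forall>v\<in>V. monomial_degree v = 2"
  obtains c where "c (ehrhart_vector (Inl None)) = \<nu>"
    "\<And>i. c (ehrhart_vector (Inl (Some i))) = \<mu> i"
    "\<And>v. v \<in> V \<Longrightarrow> c (ehrhart_vector (Inr v)) = \<kappa> v"
proof -
  define c where "c = case_sum (case_option \<nu> \<mu>) \<kappa> \<circ> inv_into (UNIV <+> V) ehrhart_vector"
  have c: "c (ehrhart_vector j) = case_sum (case_option \<nu> \<mu>) \<kappa> j" if "j \<in> UNIV <+> V" for j
    unfolding c_def o_def inv_into_f_f[OF inj_on_ehrhart_vector[OF assms] that] ..
  show thesis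
  proof (rule that)
    show "c (ehrhart_vector (Inl None)) = \<nu>"
      using c[of "Inl None"] by (simp only: InlI UNIV_I sum.case option.case)
    show "c (ehrhart_vector (Inl (Some i))) = \<mu> i" for i
      using c[of "Inl (Some i)"] by (simp only: InlI UNIV_I sum.case option.case)
    show "c (ehrhart_vector (Inr v)) = \<kappa> v" if "v \<in> V" for v
      using c[of "Inr v"] that by (simp only: InrI sum.case)
  qed
qed

lemma sum_coordinates_degree_two:
  fixes k :: "nat ^ 'n::finite \<Rightarrow> real"
  assumes "\<forall>v\<in>V. monomial_degree v = 2"
  shows "(\<Sum>i\<in>UNIV. \<Sum>v\<in>V. k v * real (v $ i)) = 2 * sum k V"
proof -
  have "(\<Sum>i\<in>UNIV. \<Sum>v\<in>V. k v * real (v $ i)) = (\<Sum>v\<in>V. k v * real (monomial_degree v))"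
    by (subst sum.swap) (simp add: monomial_degree_def sum_distrib_left)
  then show ?thesis
    using assms by (simp flip: sum_distrib_right)
qed

text \<open>
  The coefficients of the \<open>e\<^sub>i + e\<^sub>s\<^sub>+\<^sub>1\<close> are the slacks \<open>m i\<close> in the coordinate inequalities, and
  by degree two they add up to \<open>(\<Sum>i. x $ Some i) - 2 * sum k V\<close>. The last inequality says that
  the remaining coefficient, that of \<open>e\<^sub>s\<^sub>+\<^sub>1\<close>, is nonnegative.
\<close>

lemma generated_cone_ehrhart_vectors_iff:
  assumes "finite V" "\<forall>v\<in>V. monomial_degree v = 2"
  shows "x \<in> generated_cone (ehrhart_vectors V) \<longleftrightarrow>
    (\<exists>k. (\<forall>v\<in>V. 0 \<le> k v) \<and> (\<forall>i. (\<Sum>v\<in>V. k v * real (v $ i)) \<le> x $ Some i) \<and>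
      (\<Sum>i\<in>UNIV. x $ Some i) - sum k V \<le> x $ None)" (is "_ \<longleftrightarrow> (\<exists>k. ?R k)")
proof
  assume "x \<in> generated_cone (ehrhart_vectors V)"
  then obtain c where c: "\<And>b. b \<in> ehrhart_vectors V \<Longrightarrow> 0 \<le> c b"
    "(\<Sum>b\<in>ehrhart_vectors V. c b *\<^sub>R b) = x"
    by (auto simp: generated_cone_def)
  have nonneg: "0 \<le> c (ehrhart_vector j)" if "j \<in> UNIV <+> V" for j
    using c(1) that by (auto simp: ehrhart_vectors_eq)
  define k where "k = (\<lambda>v. c (ehrhart_vector (Inr v)))"
  define m where "m = (\<lambda>i. c (ehrhart_vector (Inl (Some i))))"
  have x: "x $ Some i = m i + (\<Sum>v\<in>V. k v * real (v $ i))"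
    "x $ None = c (ehrhart_vector (Inl None)) + sum m UNIV + sum k V" for i
    using c(2) unfolding sum_ehrhart_vectors[OF assms] k_def m_def by blast+
  have "0 \<le> m i" "0 \<le> c (ehrhart_vector (Inl None))" for i
    using nonneg[of "Inl _"] by (auto simp: m_def simp del: ehrhart_vector.simps)
  moreover have "(\<Sum>i\<in>UNIV. x $ Some i) = sum m UNIV + 2 * sum k V"
    by (simp add: x sum.distrib sum_coordinates_degree_two[OF assms(2)])
  moreover have "\<forall>v\<in>V. 0 \<le> k v"
    using nonneg[of "Inr _"] by (auto simp: k_def simp del: ehrhart_vector.simps)
  ultimately show "\<exists>k. ?R k"
    by (intro exI[of _ k]) (simp add: x)
next
  assume "\<exists>k. ?R k"
  then obtain k where k: "?R k" by blast
  define m where "m = (\<lambda>i. x $ Some i - (\<Sum>v\<in>V. k v * real (v $ i)))"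
  define r where "r = x $ None - (\<Sum>i\<in>UNIV. x $ Some i) + sum k V"
  obtain c where c: "c (ehrhart_vector (Inl None)) = r"
    "\<And>i. c (ehrhart_vector (Inl (Some i))) = m i"
    "\<And>v. v \<in> V \<Longrightarrow> c (ehrhart_vector (Inr v)) = k v"
    using ex_coefficients_on_ehrhart_vectors[OF assms(2)] by metis
  have "sum m UNIV = (\<Sum>i\<in>UNIV. x $ Some i) - 2 * sum k V"
    by (simp add: m_def sum_subtractf sum_coordinates_degree_two[OF assms(2)])
  then have "(\<Sum>b\<in>ehrhart_vectors V. c b *\<^sub>R b) = x"
    unfolding sum_ehrhart_vectors[OF assms] using c by (simp add: m_def r_def del: ehrhart_vector.simps)
  moreover have "0 \<le> c b" if b: "b \<in> ehrhart_vectors V" for b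
  proof -
    obtain j where j: "j \<in> UNIV <+> V" "b = ehrhart_vector j"
      using b by (auto simp: ehrhart_vectors_eq)
    have r: "0 \<le> r" and m: "0 \<le> m i" for i
      using k by (simp_all add: r_def m_def)
    show ?thesis
    proof (cases j)
      case (Inl o')
      then show ?thesis
        unfolding j(2) by (cases o') (simp_all only: c r m)
    next
      case (Inr v)
      then have "v \<in> V"
        using j(1) by auto
      then show ?thesis
        unfolding j(2) Inr using k by (simp only: c)
    qed
  qed
  ultimately show "x \<in> generated_cone (ehrhart_vectors V)"
    unfolding generated_cone_def by blast
qed

text \<open>For natural coefficients \<open>k\<close> the slacks and the remaining coefficient are natural as well.\<close>

lemma generated_semigroup_ehrhart_vectors_iff:
  fixes a :: "nat ^ 'n::finite" and x :: "real ^ 'n option"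
  assumes "finite V" "\<forall>v\<in>V. monomial_degree v = 2"
    and x: "\<And>i. x $ Some i = real (a $ i)" "x $ None = real_of_int b"
  shows "x \<in> generated_semigroup (ehrhart_vectors V) \<longleftrightarrow>
    (\<exists>k. (\<forall>i. (\<Sum>v\<in>V. k v * v $ i) \<le> a $ i) \<and> int (monomial_degree a) - int (sum k V) \<le> b)"
    (is "_ \<longleftrightarrow> (\<exists>k. ?R k)")
proof
  assume "x \<in> generated_semigroup (ehrhart_vectors V)"
  then obtain c :: "_ \<Rightarrow> nat" where c: "(\<Sum>b\<in>ehrhart_vectors V. real (c b) *\<^sub>R b) = x"
    unfolding generated_semigroup_def by blast
  define k where "k = (\<lambda>v. c (ehrhart_vector (Inr v)))"
  define m where "m = (\<lambda>i. c (ehrhart_vector (Inl (Some i))))"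
  have eq: "real (a $ i) = real (m i) + (\<Sum>v\<in>V. real (k v) * real (v $ i))"
    "real_of_int b = real (c (ehrhart_vector (Inl None))) + (\<Sum>i\<in>UNIV. real (m i)) + (\<Sum>v\<in>V. real (k v))" for i
    using c unfolding sum_ehrhart_vectors[OF assms(1,2)] k_def m_def x by blast+
  have "(\<Sum>v\<in>V. k v * v $ i) \<le> a $ i" for i
  proof -
    have "real (a $ i) = real (m i + (\<Sum>v\<in>V. k v * v $ i))"
      using eq(1)[of i] by simp
    then show ?thesis
      by (simp only: of_nat_eq_iff le_add2)
  qed
  moreover have "real (monomial_degree a) = (\<Sum>i\<in>UNIV. real (m i)) + 2 * (\<Sum>v\<in>V. real (k v))"
    by (simp add: monomial_degree_def eq sum.distrib sum_coordinates_degree_two[OF assms(2)])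
  then have "real_of_int (int (monomial_degree a) - int (sum k V)) \<le> real_of_int b"
    using eq(2) by simp
  then have "int (monomial_degree a) - int (sum k V) \<le> b"
    by (simp only: of_int_le_iff)
  ultimately show "\<exists>k. ?R k" by blast
next
  assume "\<exists>k. ?R k"
  then obtain k where k: "?R k" by blast
  define m where "m = (\<lambda>i. a $ i - (\<Sum>v\<in>V. k v * v $ i))"
  define r where "r = nat (b - int (monomial_degree a) + int (sum k V))"
  obtain c where c: "c (ehrhart_vector (Inl None)) = r"
    "\<And>i. c (ehrhart_vector (Inl (Some i))) = m i"
    "\<And>v. v \<in> V \<Longrightarrow> c (ehrhart_vector (Inr v)) = k v"
    using ex_coefficients_on_ehrhart_vectors[OF assms(2)] by metis
  have m: "real (m i) = real (a $ i) - (\<Sum>v\<in>V. real (k v) * real (v $ i))" for i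
    using k by (simp add: m_def of_nat_diff)
  have "(\<Sum>i\<in>UNIV. real (m i)) = real (monomial_degree a) - 2 * (\<Sum>v\<in>V. real (k v))"
    by (simp add: m sum_subtractf sum_coordinates_degree_two[OF assms(2)] monomial_degree_def)
  moreover have "real r = real_of_int b - real (monomial_degree a) + (\<Sum>v\<in>V. real (k v))"
    using k by (simp add: r_def)
  ultimately have "(\<Sum>b\<in>ehrhart_vectors V. real (c b) *\<^sub>R b) = x"
    unfolding sum_ehrhart_vectors[OF assms(1,2)] using c by (simp add: m x del: ehrhart_vector.simps)
  then show "x \<in> generated_semigroup (ehrhart_vectors V)"
    unfolding generated_semigroup_def by blast
qed

text \<open>
  A lattice point \<open>(a, b)\<close> of the cone corresponds to the problem of packing \<open>n = \<bar>a\<bar> - b\<close>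
  elements of \<open>V\<close> into \<open>a\<close>, where \<open>\<bar>a\<bar>\<close> is the degree of \<open>a\<close>. The cone and the
  semigroup ask for total weight at least \<open>n\<close>, the exponent sets for exactly \<open>n\<close>: real
  weights are scaled down, and natural ones are reduced by \<open>power_exponents_antimono\<close>.
\<close>

lemma hilbert_basis_iff_newton_exponents:
  fixes V :: "(nat ^ 'n::finite) set"
  assumes "finite V" "\<forall>v\<in>V. monomial_degree v = 2"
  shows "hilbert_basis (ehrhart_vectors V) \<longleftrightarrow>
    (\<forall>n\<ge>1. newton_exponents V n \<subseteq> power_exponents V n)"
proof
  assume hilbert: "hilbert_basis (ehrhart_vectors V)"
  show "\<forall>n\<ge>1. newton_exponents V n \<subseteq> power_exponents V n"
  proof (intro allI impI subsetI)
    fix n :: nat and a :: "nat ^ 'n"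
    assume "a \<in> newton_exponents V n"
    then obtain c where c: "\<forall>v\<in>V. 0 \<le> c v" "sum c V = real n"
      "\<forall>i. (\<Sum>v\<in>V. c v * real (v $ i)) \<le> real (a $ i)"
      unfolding newton_exponents_def by blast
    define b where "b = int (monomial_degree a) - int n"
    define x :: "real ^ 'n option" where
      "x = (\<chi> j. case j of Some i \<Rightarrow> real (a $ i) | None \<Rightarrow> real_of_int b)"
    have x: "x $ Some i = real (a $ i)" "x $ None = real_of_int b" for i
      by (simp_all add: x_def)
    have "x \<in> generated_cone (ehrhart_vectors V)"
      unfolding generated_cone_ehrhart_vectors_iff[OF assms] x
      using c by (intro exI[of _ c]) (simp add: b_def monomial_degree_def)
    moreover have "x \<in> integer_lattice"
      unfolding integer_lattice_def split_option_all by (simp add: x)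
    ultimately have "x \<in> generated_semigroup (ehrhart_vectors V)"
      using hilbert by (auto simp: hilbert_basis_def)
    then obtain k where k: "\<forall>i. (\<Sum>v\<in>V. k v * v $ i) \<le> a $ i"
      "int (monomial_degree a) - int (sum k V) \<le> b"
      unfolding generated_semigroup_ehrhart_vectors_iff[OF assms x] by blast
    have "a \<in> power_exponents V (sum k V)"
      using k(1) unfolding power_exponents_def by blast
    moreover have "n \<le> sum k V"
      using k(2) unfolding b_def by linarith
    ultimately show "a \<in> power_exponents V n"
      using power_exponents_antimono[OF assms(1)] by blast
  qed
next
  assume newton: "\<forall>n\<ge>1. newton_exponents V n \<subseteq> power_exponents V n"
  have "x \<in> generated_semigroup (ehrhart_vectors V)"
    if lattice: "x \<in> integer_lattice" and cone: "x \<in> generated_cone (ehrhart_vectors V)" for x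
  proof -
    obtain c where c: "\<forall>v\<in>V. 0 \<le> c v" "\<And>i. (\<Sum>v\<in>V. c v * real (v $ i)) \<le> x $ Some i"
      "(\<Sum>i\<in>UNIV. x $ Some i) - sum c V \<le> x $ None"
      using cone unfolding generated_cone_ehrhart_vectors_iff[OF assms] by blast
    define a :: "nat ^ 'n" where "a = (\<chi> i. nat \<lfloor>x $ Some i\<rfloor>)"
    have a: "x $ Some i = real (a $ i)" for i
    proof -
      have "0 \<le> (\<Sum>v\<in>V. c v * real (v $ i))"
        using c(1) by (intro sum_nonneg) simp
      then have "0 \<le> x $ Some i" using c(2)[of i] by simp
      moreover have "x $ Some i \<in> \<int>"
        using lattice by (simp add: integer_lattice_def)
      ultimately show ?thesis by (auto simp: a_def elim: Ints_cases)
    qed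
    obtain b where b: "x $ None = real_of_int b"
      using lattice by (auto simp: integer_lattice_def elim: Ints_cases)
    \<comment> \<open>If \<open>b\<close> is at least the degree of \<open>a\<close>, truncation gives \<open>n = 0\<close>, and nothing has to be
      packed.\<close>
    define n where "n = nat (int (monomial_degree a) - b)"
    have n_le: "real n \<le> sum c V"
    proof -
      have "real (monomial_degree a) - real_of_int b \<le> sum c V"
        using c(3) by (simp add: a b monomial_degree_def)
      moreover have "0 \<le> sum c V"
        using c(1) by (simp add: sum_nonneg)
      ultimately show ?thesis
        by (simp add: n_def)
    qed
    have "a \<in> power_exponents V n"
    proof (cases "n = 0")
      case True
      then show ?thesis by (simp add: power_exponents_0)
    next
      case False
      define t where "t = real n / sum c V"
      have t: "0 \<le> t" "t \<le> 1" "t * sum c V = real n"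
        using False n_le by (auto simp: t_def)
      have "(\<Sum>v\<in>V. (t * c v) * real (v $ i)) \<le> real (a $ i)" for i
      proof -
        have "(\<Sum>v\<in>V. (t * c v) * real (v $ i)) = t * (\<Sum>v\<in>V. c v * real (v $ i))"
          by (simp add: sum_distrib_left mult.assoc)
        also have "\<dots> \<le> 1 * (\<Sum>v\<in>V. c v * real (v $ i))"
          using t(2) c(1) by (intro mult_right_mono sum_nonneg) auto
        finally show ?thesis
          using c(2)[of i] a by simp
      qed
      moreover have "(\<Sum>v\<in>V. t * c v) = real n" "\<forall>v\<in>V. 0 \<le> t * c v"
        using t c(1) by (simp_all flip: sum_distrib_left)
      ultimately have "a \<in> newton_exponents V n"
        unfolding newton_exponents_def by (intro CollectI exI[of _ "\<lambda>v. t * c v"]) blast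
      moreover have "n \<ge> 1"
        using False by simp
      ultimately show ?thesis
        using newton by blast
    qed
    then obtain k where k: "sum k V = n" "\<forall>i. (\<Sum>v\<in>V. k v * v $ i) \<le> a $ i"
      unfolding power_exponents_def by blast
    then have "int (monomial_degree a) - int (sum k V) \<le> b"
      by (simp add: n_def)
    then show ?thesis
      unfolding generated_semigroup_ehrhart_vectors_iff[OF assms a b] using k(2) by blast
  qed
  moreover have "x \<in> integer_lattice \<inter> generated_cone (ehrhart_vectors V)"
    if semigroup: "x \<in> generated_semigroup (ehrhart_vectors V)" for x
  proof -
    obtain k :: "_ \<Rightarrow> nat" where x: "x = (\<Sum>b\<in>ehrhart_vectors V. real (k b) *\<^sub>R b)"
      using semigroup unfolding generated_semigroup_def by blast
    have "b $ j \<in> \<int>" if "b \<in> ehrhart_vectors V" for b j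
      using that by (cases j) (auto simp: ehrhart_vectors_def axis_def)
    then have "x \<in> integer_lattice"
      by (auto simp: x integer_lattice_def intro!: Ints_sum Ints_mult)
    moreover have "x \<in> generated_cone (ehrhart_vectors V)"
      unfolding x generated_cone_def by (intro CollectI exI[of _ "\<lambda>b. real (k b)"]) simp
    ultimately show ?thesis by blast
  qed
  moreover have "finite (ehrhart_vectors V)"
    using assms(1) by (simp add: ehrhart_vectors_def)
  ultimately show "hilbert_basis (ehrhart_vectors V)"
    unfolding hilbert_basis_def by blast
qed

theorem theorem4p1:
  fixes I :: "('k::field, 'n::finite) mpolynomial set"
    and V :: "(nat ^ 'n) set"
  assumes "finite V"
    and "\<forall>v\<in>V. monomial_degree v = 2"
    and "minimal_monomial_generators V I"
  shows "normal_ideal I \<longleftrightarrow> hilbert_basis (ehrhart_vectors V)"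
proof -
  have "I = ideal_generated (monomial ` V)"
    using assms(3) by (simp add: minimal_monomial_generators_def)
  then show ?thesis
    using normal_ideal_iff_newton_exponents[OF assms(1)]
      hilbert_basis_iff_newton_exponents[OF assms(1,2)] by metis
qed

end
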